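(* For a fixed positive integer $k$ and each $q\in\mathbb N$, let $G_q=K_q^k$ be the Cartesian product of $k$ copies of the complete graph $K_q$ on $q$ vertices. Then the chromatic polynomial $\chi_{G_q}(n)$ is a two-level polynomial of infinite depth.
   Context: $\mathbb N=\{0,1,2,\dots\}$. The Cartesian product $G\times H$ has vertices $(u,v)$ with $u\in V(G)$, $v\in V(H)$, and edges $(u,v)\sim(u,v')$ for $v\sim v'$ in $H$, and $(u,v)\sim(u',v)$ for $u\sim u'$ in $G$. So $K_q^k$ has vertex set $[q]^k$, with two tuples adjacent iff they differ in exactly one coordinate. The chromatic polynomial $\chi_G(n)$ counts colorings of the vertices of $G$ with $n$ colors such that adjacent vertices get different colors (it is $1$ for the graph with no vertices). A numerical polynomial is $g\in\mathbb Q[x]$ with $g(q)\in\mathbb Z$ for all $q\in\mathbb Z$. Two-level polynomial: let $g$ be an eventually nonnegative numerical polynomial, $S=\{q\in\mathbb N: g(q)\ge0\}$, $e:S\to\mathbb N\cup\{-1,\infty\}$. A two-level polynomial of degree function $g$ and depth function $e$ is a sequence of polynomials $\{f_q\}_{q\in S}$, $f_q(n)$ of degree $g(q)$, such that, writing $f_q(n)=\sum_{r\ge0}c_r(q)n^{g(q)-r}$ with $c_r(q)=0$ for $r>g(q)$, there exist polynomials $\{\phi_r(q)\}_{r\ge0}$ with $c_r(q)=\phi_r(q)$ for every $q\in S$ and every $r\le e(q)$. Infinite depth means $e(q)=\infty$ for all $q\in S$, i.e. the equality holds for all $r\ge 0$ (including $r>g(q)$, where $\phi_r(q)=0$). Here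 the degree function is the number of vertices, $q^k$. *)

theory Defs
  imports
    "Graph_Theory.Kuratowski"
    "HOL-Computational_Algebra.Polynomial"
    "HOL-Library.Extended_Real"
    "HOL-Library.FuncSet"
begin

section \<open>Cartesian products of graphs\<close>

text \<open>A finite simple graph is a \<^locale>\<open>pair_graph\<close>: the arc set \<^const>\<open>parcs\<close> is a finite, symmetric,
  irreflexive relation on the finite vertex set \<^const>\<open>pverts\<close>.\<close>

definition complete_graph :: "nat \<Rightarrow> nat pair_pre_digraph" where
  "complete_graph q = \<lparr>pverts = {..<q}, parcs = {(u, v). u < q \<and> v < q \<and> u \<noteq> v}\<rparr>"

definition cartesian_product ::
    "'a pair_pre_digraph \<Rightarrow> 'b pair_pre_digraph \<Rightarrow> ('a \<times> 'b) pair_pre_digraph" where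
  "cartesian_product G H =
     \<lparr>pverts = pverts G \<times> pverts H,
      parcs = {((u, v), (u, v')) | u v v'. u \<in> pverts G \<and> (v, v') \<in> parcs H}
            \<union> {((u, v), (u', v)) | u u' v. (u, u') \<in> parcs G \<and> v \<in> pverts H}\<rparr>"

definition relabel :: "('a \<Rightarrow> 'b) \<Rightarrow> 'a pair_pre_digraph \<Rightarrow> 'b pair_pre_digraph" where
  "relabel f G = \<lparr>pverts = f ` pverts G, parcs = map_prod f f ` parcs G\<rparr>"

text \<open>Tuples are represented as lists so that the vertex type does not depend on the number of
  factors; the relabelling turns a pair of a vertex and a tuple into a tuple.\<close>

primrec cartesian_power :: "'a pair_pre_digraph \<Rightarrow> nat \<Rightarrow> 'a list pair_pre_digraph" where
  "cartesian_power G 0 = \<lparr>pverts = {[]}, parcs = {}\<rparr>"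
| "cartesian_power G (Suc k) =
     relabel (\<lambda>(x, xs). x # xs) (cartesian_product G (cartesian_power G k))"

lemma complete_graph_simps [simp]:
  "pverts (complete_graph q) = {..<q}"
  "(u, v) \<in> parcs (complete_graph q) \<longleftrightarrow> u < q \<and> v < q \<and> u \<noteq> v"
  by (auto simp: complete_graph_def)

lemma complete_digraph_complete_graph: "complete_digraph q (with_proj (complete_graph q))"
  by (auto simp: complete_digraph_pair_def)

lemma pverts_cartesian_power:
  "pverts (cartesian_power G k) = {xs. length xs = k \<and> set xs \<subseteq> pverts G}"
proof (induction k)
  case 0
  show ?case by auto
next
  case (Suc k)
  show ?case
    by (auto simp: Suc relabel_def cartesian_product_def length_Suc_conv image_iff)
qed

lemma parcs_cartesian_power_complete:
  "parcs (cartesian_power (complete_graph q) k) =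
     {(xs, ys). xs \<in> pverts (cartesian_power (complete_graph q) k) \<and>
                ys \<in> pverts (cartesian_power (complete_graph q) k) \<and>
                card {i. i < k \<and> xs ! i \<noteq> ys ! i} = 1}"
proof (induction k)
  case 0
  show ?case by auto
next
  case (Suc k)
  let ?V = "\<lambda>k. pverts (cartesian_power (complete_graph q) k)"
  let ?D = "\<lambda>k xs ys. {i. i < k \<and> (xs ! i :: nat) \<noteq> ys ! i}"
  have D: "?D (Suc k) (x # xs) (y # ys) = (if x = y then {} else {0}) \<union> Suc ` ?D k xs ys"
    for x xs y ys
  proof (rule set_eqI)
    fix i
    show "i \<in> ?D (Suc k) (x # xs) (y # ys) \<longleftrightarrow>
        i \<in> (if x = y then {} else {0}) \<union> Suc ` ?D k xs ys"
      by (cases i) auto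
  qed
  have c: "card (?D (Suc k) (x # xs) (y # ys)) = 1 \<longleftrightarrow>
      (x = y \<and> card (?D k xs ys) = 1) \<or> (x \<noteq> y \<and> ?D k xs ys = {})" for x xs y ys
    unfolding D by (auto simp: card_image)
  have e: "?D k xs ys = {} \<longleftrightarrow> xs = ys" if "xs \<in> ?V k" "ys \<in> ?V k" for xs ys
    using that by (auto simp: pverts_cartesian_power list_eq_iff_nth_eq)
  have V: "zs \<in> ?V (Suc k) \<longleftrightarrow> (\<exists>z zs'. zs = z # zs' \<and> z < q \<and> zs' \<in> ?V k)" for zs
    unfolding pverts_cartesian_power by (cases zs) auto
  have E: "(as, bs) \<in> parcs (cartesian_power (complete_graph q) (Suc k)) \<longleftrightarrow>
      (\<exists>x xs y ys. as = x # xs \<and> bs = y # ys \<and> x < q \<and> y < q \<and> xs \<in> ?V k \<and> ys \<in> ?V k \<and>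
        ((x = y \<and> card (?D k xs ys) = 1) \<or> (x \<noteq> y \<and> xs = ys)))" for as bs
    by (auto simp: relabel_def cartesian_product_def Suc image_iff Bex_def)
  have F: "as \<in> ?V (Suc k) \<and> bs \<in> ?V (Suc k) \<and> card (?D (Suc k) as bs) = 1 \<longleftrightarrow>
      (\<exists>x xs y ys. as = x # xs \<and> bs = y # ys \<and> x < q \<and> y < q \<and> xs \<in> ?V k \<and> ys \<in> ?V k \<and>
        card (?D (Suc k) (x # xs) (y # ys)) = 1)" for as bs
    unfolding V by blast
  have "(as, bs) \<in> parcs (cartesian_power (complete_graph q) (Suc k)) \<longleftrightarrow>
      as \<in> ?V (Suc k) \<and> bs \<in> ?V (Suc k) \<and> card (?D (Suc k) as bs) = 1" for as bs
    unfolding E F c using e by blast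
  then show ?case by (simp only: set_eq_iff split_paired_All mem_Collect_eq prod.case simp_thms)
qed

lemma pair_graph_cartesian_power_complete:
  "pair_graph (cartesian_power (complete_graph q) k)"
proof -
  let ?G = "cartesian_power (complete_graph q) k"
  have "finite (pverts ?G)"
    using finite_lists_length_eq[of "{..<q}" k]
    by (simp add: pverts_cartesian_power conj_commute)
  moreover have sub: "parcs ?G \<subseteq> pverts ?G \<times> pverts ?G"
    by (auto simp: parcs_cartesian_power_complete)
  ultimately have fin: "finite (pverts ?G)" "finite (parcs ?G)"
    by (auto intro: finite_subset)
  have "sym (parcs ?G)"
    by (auto simp: sym_def parcs_cartesian_power_complete eq_commute)
  moreover have "fst a \<noteq> snd a" if "a \<in> parcs ?G" for a
    using that by (auto simp: parcs_cartesian_power_complete)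
  ultimately show ?thesis
    using sub fin by unfold_locales (auto simp: symmetric_def)
qed

section \<open>The chromatic polynomial\<close>

definition proper_colorings :: "'a pair_pre_digraph \<Rightarrow> nat \<Rightarrow> ('a \<Rightarrow> nat) set" where
  "proper_colorings G n = {c \<in> pverts G \<rightarrow>\<^sub>E {..<n}. \<forall>(u, v) \<in> parcs G. c u \<noteq> c v}"

definition chromatic_polynomial :: "'a pair_pre_digraph \<Rightarrow> rat poly" where
  "chromatic_polynomial G =
     (THE p. \<forall>n. poly p (of_nat n) = of_nat (card (proper_colorings G n)))"

lemma poly_eq_of_nat_eqI:
  fixes p p' :: "rat poly"
  assumes "\<And>n. poly p (of_nat n) = poly p' (of_nat n)"
  shows "p = p'"
proof (rule ccontr)
  assume "p \<noteq> p'"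
  then have "finite {x. poly (p - p') x = 0}"
    by (intro poly_roots_finite) simp
  moreover have "range (of_nat :: nat \<Rightarrow> rat) \<subseteq> {x. poly (p - p') x = 0}"
    using assms by auto
  ultimately have "finite (range (of_nat :: nat \<Rightarrow> rat))"
    by (rule rev_finite_subset)
  then show False
    using finite_imageD[of "of_nat :: nat \<Rightarrow> rat" UNIV] inj_of_nat by auto
qed

lemma ex_chromatic_polynomial:
  assumes "pair_fin_digraph G"
  shows "\<exists>p :: rat poly. \<forall>n. poly p (of_nat n) = of_nat (card (proper_colorings G n))"
proof -
  interpret pair_fin_digraph G by fact
  define V where "V = pverts G"
  have finV: "finite V" unfolding V_def by (rule pair_finite_verts)
  define A :: "nat set \<Rightarrow> ('a \<Rightarrow> nat) set"
    where "A S = {c \<in> V \<rightarrow>\<^sub>E S. c ` V = S \<and> (\<forall>(u, v) \<in> parcs G. c u \<noteq> c v)}" for S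
  define B :: "nat \<Rightarrow> rat poly" where
    "B j = smult (1 / fact j) (\<Prod>i<j. [:- of_nat i, 1:])" for j
  have B: "poly (B j) (of_nat n) = of_nat (n choose j)" for j n
    by (simp add: B_def poly_prod binomial_gbinomial gbinomial_prod_rev atLeast0LessThan)
  have arcs_V: "u \<in> V" "v \<in> V" if "(u, v) \<in> parcs G" for u v
    using that in_arcsD1 in_arcsD2 unfolding V_def by auto
  have finA: "finite (A S)" if "finite S" for S
    by (rule finite_subset[of _ "V \<rightarrow>\<^sub>E S"]) (auto simp: A_def finV that intro: finite_PiE)
  have card_A: "card (A S) = card (A T)" if h: "bij_betw h S T" for h S T
  proof -
    define g where "g = inv_into S h"
    have gh: "g (h x) = x" "h x \<in> T" if "x \<in> S" for x
      using h that unfolding g_def by (auto simp: bij_betw_def)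
    have hg: "h (g y) = y" "g y \<in> S" if "y \<in> T" for y
      using h that unfolding g_def by (auto simp: bij_betw_def f_inv_into_f inv_into_into)
    have maps: "(\<lambda>c. restrict (f \<circ> c) V) ` A S' \<subseteq> A T'"
      if f: "bij_betw f S' T'" for f :: "nat \<Rightarrow> nat" and S' T'
    proof clarify
      fix c assume c: "c \<in> A S'"
      have "restrict (f \<circ> c) V ` V = f ` c ` V" by (simp add: image_comp)
      moreover have "f ` c ` V = T'" using c f by (simp add: A_def bij_betw_def)
      moreover have "\<forall>(u, v) \<in> parcs G. restrict (f \<circ> c) V u \<noteq> restrict (f \<circ> c) V v"
      proof clarify
        fix u v assume uv: "(u, v) \<in> parcs G"
          and eq: "restrict (f \<circ> c) V u = restrict (f \<circ> c) V v"
        then have "f (c u) = f (c v)" using arcs_V[OF uv] by simp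
        moreover have "c u \<in> S'" "c v \<in> S'" using arcs_V[OF uv] c by (auto simp: A_def)
        ultimately have "c u = c v" using f by (auto simp: bij_betw_def inj_on_def)
        then show False using uv c by (auto simp: A_def)
      qed
      ultimately show "restrict (f \<circ> c) V \<in> A T'" by (auto simp: A_def)
    qed
    have "bij_betw (\<lambda>c. restrict (h \<circ> c) V) (A S) (A T)"
    proof (rule bij_betw_byWitness[where f' = "\<lambda>c. restrict (g \<circ> c) V"])
      show "\<forall>c\<in>A S. restrict (g \<circ> restrict (h \<circ> c) V) V = c"
        by (auto simp: A_def fun_eq_iff restrict_def gh PiE_def extensional_def)
      show "\<forall>c\<in>A T. restrict (h \<circ> restrict (g \<circ> c) V) V = c"
        by (auto simp: A_def fun_eq_iff restrict_def hg PiE_def extensional_def)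
      show "(\<lambda>c. restrict (h \<circ> c) V) ` A S \<subseteq> A T" using maps[OF h] .
      show "(\<lambda>c. restrict (g \<circ> c) V) ` A T \<subseteq> A S"
        using maps bij_betw_inv_into[OF h] unfolding g_def by blast
    qed
    then show ?thesis by (rule bij_betw_same_card)
  qed
  have A_0: "card (A {..<j}) = 0" if "j > card V" for j
  proof -
    have "A {..<j} = {}"
    proof (rule ccontr)
      assume "A {..<j} \<noteq> {}"
      then obtain c where "c ` V = {..<j}" by (auto simp: A_def)
      then have "j \<le> card V" using card_image_le[OF finV, of c] by simp
      then show False using that by simp
    qed
    then show ?thesis by simp
  qed
  define p where "p = (\<Sum>j\<le>card V. smult (of_nat (card (A {..<j}))) (B j))"
  have "poly p (of_nat n) = of_nat (card (proper_colorings G n))" for n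
  proof -
    have "proper_colorings G n = (\<Union>S\<in>Pow {..<n}. A S)"
      by (auto simp: proper_colorings_def A_def V_def PiE_def Pi_def)
    moreover have "card (\<Union>S\<in>Pow {..<n}. A S) = (\<Sum>S\<in>Pow {..<n}. card (A S))"
    proof (rule card_UN_disjoint)
      show "\<forall>S\<in>Pow {..<n}. finite (A S)"
        using finA finite_subset[OF _ finite_lessThan[of n]] by auto
      show "\<forall>S\<in>Pow {..<n}. \<forall>T\<in>Pow {..<n}. S \<noteq> T \<longrightarrow> A S \<inter> A T = {}"
        by (auto simp: A_def)
    qed simp
    moreover have "(\<Sum>S\<in>Pow {..<n}. card (A S)) = (\<Sum>S\<in>Pow {..<n}. card (A {..<card S}))"
    proof (rule sum.cong[OF refl])
      fix S assume "S \<in> Pow {..<n}"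
      then have "finite S" using finite_subset by auto
      then obtain h where "bij_betw h S {..<card S}"
        using ex_bij_betw_finite_nat atLeast0LessThan by metis
      then show "card (A S) = card (A {..<card S})" by (rule card_A)
    qed
    moreover have "(\<Sum>S\<in>Pow {..<n}. card (A {..<card S})) =
        (\<Sum>j\<le>n. \<Sum>S\<in>{S \<in> Pow {..<n}. card S = j}. card (A {..<card S}))"
      by (rule sum.group[symmetric]) (auto intro: order.trans[OF card_mono[OF finite_lessThan]])
    moreover have "\<dots> = (\<Sum>j\<le>n. (n choose j) * card (A {..<j}))"
    proof (rule sum.cong[OF refl])
      fix j
      have "card {S \<in> Pow {..<n}. card S = j} = n choose j"
        using n_subsets[of "{..<n}" j] by (simp add: Pow_def)
      then show "(\<Sum>S\<in>{S \<in> Pow {..<n}. card S = j}. card (A {..<card S})) =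
          (n choose j) * card (A {..<j})" by simp
    qed
    moreover have "\<dots> = (\<Sum>j\<le>max n (card V). (n choose j) * card (A {..<j}))"
      by (rule sum.mono_neutral_left) (auto simp: binomial_eq_0)
    moreover have "\<dots> = (\<Sum>j\<le>card V. (n choose j) * card (A {..<j}))"
      by (rule sum.mono_neutral_right) (auto simp: A_0)
    ultimately have "card (proper_colorings G n) = (\<Sum>j\<le>card V. (n choose j) * card (A {..<j}))"
      by simp
    then show ?thesis
      by (simp add: p_def poly_sum B mult.commute)
  qed
  then show ?thesis by blast
qed

lemma poly_chromatic_polynomial:
  assumes "pair_fin_digraph G"
  shows "poly (chromatic_polynomial G) (of_nat n) = of_nat (card (proper_colorings G n))"
proof -
  obtain p :: "rat poly"
    where p: "\<forall>n. poly p (of_nat n) = of_nat (card (proper_colorings G n))"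
    using ex_chromatic_polynomial[OF assms] by blast
  have "\<forall>n. poly (chromatic_polynomial G) (of_nat n) = of_nat (card (proper_colorings G n))"
    unfolding chromatic_polynomial_def
  proof (rule theI[of _ p])
    fix p' :: "rat poly"
    assume "\<forall>n. poly p' (of_nat n) = of_nat (card (proper_colorings G n))"
    then show "p' = p" using p by (intro poly_eq_of_nat_eqI) simp
  qed (fact p)
  then show ?thesis ..
qed

section \<open>Two-level polynomials\<close>

definition numerical_poly :: "rat poly \<Rightarrow> bool" where
  "numerical_poly g \<longleftrightarrow> (\<forall>q :: int. poly g (of_int q) \<in> \<int>)"

definition eventually_nonneg_poly :: "rat poly \<Rightarrow> bool" where
  "eventually_nonneg_poly g \<longleftrightarrow> (\<forall>\<^sub>F q :: nat in sequentially. 0 \<le> poly g (of_nat q))"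

definition level_set :: "rat poly \<Rightarrow> nat set" where
  "level_set g = {q. 0 \<le> poly g (of_nat q)}"

text \<open>The coefficient of the power that is \<open>r\<close> below the leading one.\<close>

definition coeff_from_top :: "'a::zero poly \<Rightarrow> nat \<Rightarrow> 'a" where
  "coeff_from_top p r = (if r \<le> degree p then coeff p (degree p - r) else 0)"

text \<open>The depth takes values in the naturals together with \<open>-1\<close> and \<open>\<infinity>\<close>. The members of \<open>f\<close> at
  indices outside \<^term>\<open>level_set g\<close> are irrelevant. The zero polynomial has no degree, whereas
  \<^const>\<open>degree\<close> gives it degree \<open>0\<close>, so it is excluded explicitly.\<close>

definition two_level_polynomial ::
    "rat poly \<Rightarrow> (nat \<Rightarrow> ereal) \<Rightarrow> (nat \<Rightarrow> rat poly) \<Rightarrow> bool" where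
  "two_level_polynomial g e f \<longleftrightarrow>
     numerical_poly g \<and> eventually_nonneg_poly g \<and>
     (\<forall>q\<in>level_set g. e q = -1 \<or> e q = \<infinity> \<or> (\<exists>m :: nat. e q = ereal (real m))) \<and>
     (\<forall>q\<in>level_set g. f q \<noteq> 0 \<and> of_nat (degree (f q)) = poly g (of_nat q)) \<and>
     (\<exists>\<phi> :: nat \<Rightarrow> rat poly. \<forall>q\<in>level_set g. \<forall>r :: nat.
        ereal (real r) \<le> e q \<longrightarrow> coeff_from_top (f q) r = poly (\<phi> r) (of_nat q))"

end

theory Submission
  imports Defs
begin

text \<open>
  Whitney's expansion writes the chromatic polynomial of a graph with vertex set \<open>V\<close> as a signed sum
  of \<open>n ^ (card V - rank A)\<close> over all sets \<open>A\<close> of arcs, where the rank of \<open>A\<close> is the number of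
  vertices touched by \<open>A\<close> minus the number of connected components that they form. So the coefficient
  \<open>r\<close> below the leading one is the number of arc sets of rank \<open>r\<close>, each counted with sign
  \<open>(-1) ^ card A\<close> (\<open>coeff_from_top_chromatic_polynomial\<close>). The rank of \<open>A\<close> does not refer to \<open>V\<close>,
  and this is what allows the graphs \<open>K\<^sub>q\<^sup>k\<close> with different \<open>q\<close> to be compared.

  Each component of \<open>A\<close> has at least two vertices, so an arc set of rank \<open>r\<close> touches at most \<open>2 * r\<close>
  vertices (\<open>card_Field_le_twice_rank\<close>). In \<open>K\<^sub>q\<^sup>k\<close> a vertex is a word of \<open>k\<close> letters, and hence at most
  \<open>2 * r * k\<close> of the \<open>q\<close> letters can occur in \<open>A\<close>. Group the arc sets of rank \<open>r\<close> by the set \<open>S\<close> of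
  letters that occur. Renaming letters is an isomorphism, so the signed count \<open>F S\<close> of a group depends
  on \<open>card S\<close> only (\<open>sum_over_letters_inj\<close>), and the coefficient is the sum of
  \<open>(q choose s) * F {..<s}\<close> over \<open>s \<le> 2 * r * k\<close>. This is a polynomial in \<open>q\<close>
  (\<open>ex_poly_sum_over_subsets\<close>), and the formula holds for every \<open>q\<close>, without a bound on \<open>r\<close>.
\<close>

section \<open>The rank of a set of arcs\<close>

definition conn :: "'a rel \<Rightarrow> 'a rel" where
  "conn A = (A \<union> A\<inverse>)\<^sup>*"

text \<open>The number of arcs in a spanning forest of \<open>A\<close>, that is, the rank in the cycle matroid. Only
  vertices that lie on an arc are mentioned, so the rank is the same in every graph containing \<open>A\<close>.\<close>

definition graphic_rank :: "'a rel \<Rightarrow> nat" where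
  "graphic_rank A = card (Field A) - card (Field A // conn A)"

lemma equiv_conn: "equiv UNIV (conn A)"
proof -
  have "sym (A \<union> A\<inverse>)"
    by (auto simp: sym_def)
  then show ?thesis
    unfolding conn_def by (intro equivI refl_rtrancl sym_rtrancl trans_rtrancl) auto
qed

lemma arc_in_conn: "(u, v) \<in> A \<Longrightarrow> (u, v) \<in> conn A" "(u, v) \<in> A \<Longrightarrow> (v, u) \<in> conn A"
  unfolding conn_def by auto

lemma constant_on_conn:
  assumes "(x, y) \<in> conn A" and "\<And>u v. (u, v) \<in> A \<Longrightarrow> c u = c v"
  shows "c x = c y"
  using assms(1) unfolding conn_def by induction (use assms(2) in auto)

lemma conn_Field:
  assumes "(x, y) \<in> conn A"
  shows "x = y \<or> (x \<in> Field A \<and> y \<in> Field A)"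
  using assms unfolding conn_def by induction (auto intro: FieldI1 FieldI2)

lemma conn_class_isolated: "x \<notin> Field A \<Longrightarrow> conn A `` {x} = {x}"
  using conn_Field[of x _ A] equiv_class_self[OF equiv_conn, of x A] by auto

lemma conn_class_subset_Field: "x \<in> Field A \<Longrightarrow> conn A `` {x} \<subseteq> Field A"
  using conn_Field[of x _ A] by blast

lemma finite_quotient_conn: "finite V \<Longrightarrow> finite (V // conn A)"
  by (simp add: quotient_def)

lemma card_quotient_conn_le: "finite V \<Longrightarrow> card (V // conn A) \<le> card V"
proof -
  assume "finite V"
  moreover have "V // conn A = (\<lambda>x. conn A `` {x}) ` V"
    by (auto simp: quotient_def)
  ultimately show ?thesis
    by (simp add: card_image_le)
qed

lemma graphic_rank_le: "graphic_rank A \<le> card (Field A)"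
  by (simp add: graphic_rank_def)

text \<open>A vertex of \<open>V\<close> that lies on no arc is a component by itself; it adds one to both
  \<open>card V\<close> and the number of components.\<close>

lemma card_quotient_conn:
  assumes "finite V" and "Field A \<subseteq> V"
  shows "card (V // conn A) = card V - graphic_rank A"
proof -
  have finF: "finite (Field A)"
    using assms finite_subset by blast
  have "V // conn A = Field A // conn A \<union> (\<lambda>x. {x}) ` (V - Field A)"
    using assms(2) conn_class_isolated[of _ A] by (fastforce simp: quotient_def)
  moreover have "Field A // conn A \<inter> (\<lambda>x. {x}) ` (V - Field A) = {}"
    using conn_class_subset_Field[of _ A] equiv_class_self[OF equiv_conn]
    by (fastforce simp: quotient_def)
  moreover have "card ((\<lambda>x. {x}) ` (V - Field A)) = card V - card (Field A)"
    using assms finF by (simp add: card_image card_Diff_subset)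
  ultimately have "card (V // conn A) = card (Field A // conn A) + (card V - card (Field A))"
    using assms finF by (simp add: card_Un_disjoint finite_quotient_conn)
  moreover have "card (Field A) \<le> card V"
    using assms card_mono by blast
  ultimately show ?thesis
    using card_quotient_conn_le[OF finF, of A] by (simp add: graphic_rank_def)
qed

text \<open>In the absence of loops a vertex on an arc has a neighbour other than itself, so at most half as
  many components as vertices are formed.\<close>

lemma card_Field_le_twice_rank:
  assumes "finite A" and "\<And>u v. (u, v) \<in> A \<Longrightarrow> u \<noteq> v"
  shows "card (Field A) \<le> 2 * graphic_rank A"
proof -
  let ?Q = "Field A // conn A"
  have finF: "finite (Field A)"
    using assms(1) by (simp add: finite_Field)
  have sub: "X \<subseteq> Field A" if "X \<in> ?Q" for X
    using that conn_class_subset_Field[of _ A] by (auto elim!: quotientE)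
  have "2 \<le> card X" if X: "X \<in> ?Q" for X
  proof -
    obtain x where x: "x \<in> Field A" "X = conn A `` {x}"
      using X by (rule quotientE)
    then obtain y where y: "(x, y) \<in> A \<or> (y, x) \<in> A"
      by (auto simp: Field_def)
    then have "x \<noteq> y"
      using assms(2) by blast
    moreover have "y \<in> X" "x \<in> X"
      using x y arc_in_conn[of _ _ A] equiv_class_self[OF equiv_conn] by auto
    ultimately have "{x, y} \<subseteq> X" "card {x, y} = 2"
      by auto
    then show ?thesis
      using card_mono[of X "{x, y}"] finite_subset[OF sub[OF X] finF] by simp
  qed
  then have "(\<Sum>X\<in>?Q. 2) \<le> (\<Sum>X\<in>?Q. card X)"
    by (intro sum_mono)
  also have "\<dots> = card (\<Union>?Q)"
  proof (rule card_Union_disjoint[symmetric])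
    have "?Q \<subseteq> UNIV // conn A"
      by (auto simp: quotient_def)
    then show "pairwise disjnt ?Q"
      using quotient_disj[OF equiv_conn] by (fastforce simp: pairwise_def disjnt_def)
  qed (use sub finF finite_subset in blast)
  also have "\<dots> \<le> card (Field A)"
    using sub finF by (intro card_mono) auto
  finally show ?thesis
    by (simp add: graphic_rank_def)
qed

lemma conn_map_prod:
  assumes "inj f"
  shows "conn (map_prod f f ` A) `` {f x} = f ` (conn A `` {x})"
proof
  have "(x, y) \<in> conn A \<Longrightarrow> (f x, f y) \<in> conn (map_prod f f ` A)" for y
    unfolding conn_def
  proof (induction rule: rtrancl_induct)
    case (step y z)
    then have "(f y, f z) \<in> map_prod f f ` A \<union> (map_prod f f ` A)\<inverse>"
      by auto
    with step.IH show ?case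
      by (rule rtrancl_into_rtrancl)
  qed simp
  then show "f ` (conn A `` {x}) \<subseteq> conn (map_prod f f ` A) `` {f x}"
    by auto
next
  have "\<exists>y. z = f y \<and> (x, y) \<in> conn A" if "(f x, z) \<in> conn (map_prod f f ` A)" for z
    using that unfolding conn_def
  proof (induction rule: rtrancl_induct)
    case (step y z)
    then obtain y' where y': "y = f y'" "(x, y') \<in> (A \<union> A\<inverse>)\<^sup>*"
      by blast
    with step.hyps(2) obtain z' where z': "z = f z'" "(y', z') \<in> A \<union> A\<inverse>"
      using injD[OF assms] by auto
    show ?case
      using z'(1) rtrancl_into_rtrancl[OF y'(2) z'(2)] by blast
  qed auto
  then show "conn (map_prod f f ` A) `` {f x} \<subseteq> f ` (conn A `` {x})"
    by blast
qed

lemma Field_map_prod: "Field (map_prod f f ` A) = f ` Field A"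
  by (force simp: Field_def)

lemma graphic_rank_map_prod:
  assumes "inj f"
  shows "graphic_rank (map_prod f f ` A) = graphic_rank A"
proof -
  have "(f ` Field A) // conn (map_prod f f ` A) = (`) f ` (Field A // conn A)"
    by (auto simp: quotient_def conn_map_prod[OF assms])
  moreover have "inj_on ((`) f) (Field A // conn A)"
    using assms by (metis inj_image_eq_iff inj_onI)
  moreover have "inj_on f (Field A)"
    using assms by (rule inj_on_subset) simp
  ultimately show ?thesis
    by (simp add: graphic_rank_def Field_map_prod card_image)
qed

section \<open>Whitney's expansion\<close>

text \<open>Such a coloring is constant on components, so it amounts to a free choice of a color for each of
  the \<open>card V - graphic_rank A\<close> components.\<close>

lemma card_colorings_constant_on_arcs:
  assumes V: "finite V" and A: "Field A \<subseteq> V"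
  shows "card {c \<in> V \<rightarrow>\<^sub>E {..<n :: nat}. \<forall>(u, v) \<in> A. c u = c v} = n ^ (card V - graphic_rank A)"
proof -
  let ?Q = "V // conn A"
  let ?C = "{c \<in> V \<rightarrow>\<^sub>E {..<n}. \<forall>(u, v) \<in> A. c u = c v}"
  let ?lift = "\<lambda>g. restrict (\<lambda>x. g (conn A `` {x})) V"
  have "bij_betw ?lift (?Q \<rightarrow>\<^sub>E {..<n}) ?C"
    unfolding bij_betw_def
  proof
    show "inj_on ?lift (?Q \<rightarrow>\<^sub>E {..<n})"
    proof (rule inj_onI)
      fix g h assume g: "g \<in> ?Q \<rightarrow>\<^sub>E {..<n}" and h: "h \<in> ?Q \<rightarrow>\<^sub>E {..<n}"
        and eq: "?lift g = ?lift h"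
      have "g (conn A `` {x}) = h (conn A `` {x})" if "x \<in> V" for x
        using fun_cong[OF eq, of x] that by simp
      then show "g = h"
        using g h by (intro PiE_ext) (auto elim!: quotientE)
    qed
    show "?lift ` (?Q \<rightarrow>\<^sub>E {..<n}) = ?C"
    proof
      have "conn A `` {u} = conn A `` {v}" if "(u, v) \<in> A" for u v
        by (rule equiv_class_eq[OF equiv_conn arc_in_conn(1)[OF that]])
      moreover have "u \<in> V" "v \<in> V" if "(u, v) \<in> A" for u v
        using that A by (auto simp: Field_def)
      ultimately show "?lift ` (?Q \<rightarrow>\<^sub>E {..<n}) \<subseteq> ?C"
        by (fastforce intro: quotientI)
    next
      show "?C \<subseteq> ?lift ` (?Q \<rightarrow>\<^sub>E {..<n})"
      proof
        fix c assume c: "c \<in> ?C"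
        \<comment> \<open>\<open>c\<close> takes a single value on each component, so any representative gives its color.\<close>
        let ?g = "restrict (\<lambda>X. c (SOME x. x \<in> X \<inter> V)) ?Q"
        have some: "c (SOME y. y \<in> conn A `` {x} \<inter> V) = c x" "(SOME y. y \<in> conn A `` {x} \<inter> V) \<in> V"
          if "x \<in> V" for x
        proof -
          have "x \<in> conn A `` {x} \<inter> V"
            using that equiv_class_self[OF equiv_conn, of x A] by simp
          then have *: "(SOME y. y \<in> conn A `` {x} \<inter> V) \<in> conn A `` {x} \<inter> V"
            by (rule someI)
          then show "(SOME y. y \<in> conn A `` {x} \<inter> V) \<in> V"
            by blast
          show "c (SOME y. y \<in> conn A `` {x} \<inter> V) = c x"
          proof (rule constant_on_conn[of x _ A c, symmetric])
            show "(x, SOME y. y \<in> conn A `` {x} \<inter> V) \<in> conn A"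
              using * by blast
            show "c u = c v" if "(u, v) \<in> A" for u v
              using c that by blast
          qed
        qed
        have "?g \<in> ?Q \<rightarrow>\<^sub>E {..<n}"
          using c some by (auto elim!: quotientE)
        moreover have "?lift ?g = c"
          using c some by (auto simp: fun_eq_iff restrict_def quotientI PiE_def extensional_def)
        ultimately show "c \<in> ?lift ` (?Q \<rightarrow>\<^sub>E {..<n})"
          by (intro image_eqI[where x = ?g]) (rule sym)
      qed
    qed
  qed
  then have "card ?C = card (?Q \<rightarrow>\<^sub>E {..<n})"
    by (rule bij_betw_same_card[symmetric])
  then show ?thesis
    by (simp add: card_PiE finite_quotient_conn V card_quotient_conn[OF V A])
qed

lemma prod_of_bool:
  "finite A \<Longrightarrow> (\<Prod>a\<in>A. of_bool (P a)) = (of_bool (\<forall>a\<in>A. P a) :: 'b :: comm_semiring_1)"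
  by (induction A rule: finite_induct) auto

text \<open>A coloring is proper iff the product of \<open>1 - [c u = c v]\<close> over the arcs \<open>(u, v)\<close> is \<open>1\<close>;
  otherwise the product is \<open>0\<close>. Expanding it and summing over all colorings gives the formula. An edge
  of a simple graph is a pair of opposite arcs and contributes its factor twice. This is harmless, as
  each factor is \<open>0\<close> or \<open>1\<close>, and so the sum may range over sets of arcs instead of sets of edges.\<close>

lemma chromatic_polynomial_Whitney:
  assumes "pair_fin_digraph G"
  shows "chromatic_polynomial G =
    (\<Sum>A\<in>Pow (parcs G). monom ((-1) ^ card A) (card (pverts G) - graphic_rank A))"
    (is "_ = ?p")
proof (rule poly_eq_of_nat_eqI)
  fix n :: nat
  interpret pair_fin_digraph G by fact
  let ?V = "pverts G" and ?E = "parcs G"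
  let ?M = "?V \<rightarrow>\<^sub>E {..<n}"
  have finM: "finite ?M"
    by (rule finite_PiE) auto
  have Field: "Field A \<subseteq> ?V" if "A \<subseteq> ?E" for A
    using that in_arcsD1 in_arcsD2 by (fastforce simp: Field_def)
  have "of_nat (card (proper_colorings G n)) =
      (\<Sum>c\<in>?M. of_bool (\<forall>(u, v)\<in>?E. c u \<noteq> c v) :: rat)"
    using finM by (simp add: proper_colorings_def sum.inter_filter[symmetric] of_bool_def
        flip: of_nat_sum card_eq_sum)
  also have "\<dots> = (\<Sum>c\<in>?M. \<Prod>a\<in>?E. 1 - of_bool (c (fst a) = c (snd a)))"
  proof (rule sum.cong[OF refl])
    fix c
    have "(\<Prod>a\<in>?E. 1 - of_bool (c (fst a) = c (snd a)) :: rat) =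
        (\<Prod>a\<in>?E. of_bool (c (fst a) \<noteq> c (snd a)))"
      by (intro prod.cong) auto
    also have "\<dots> = of_bool (\<forall>(u, v)\<in>?E. c u \<noteq> c v)"
      by (simp add: prod_of_bool case_prod_beta)
    finally show "of_bool (\<forall>(u, v)\<in>?E. c u \<noteq> c v) =
        (\<Prod>a\<in>?E. 1 - of_bool (c (fst a) = c (snd a)) :: rat)" ..
  qed
  also have "\<dots> = (\<Sum>c\<in>?M. \<Sum>A\<in>Pow ?E. (-1) ^ card A * of_bool (\<forall>(u, v)\<in>A. c u = c v))"
  proof (rule sum.cong[OF refl])
    fix c
    have "(\<Prod>a\<in>A. of_bool (c (fst a) = c (snd a)) :: rat) = of_bool (\<forall>(u, v)\<in>A. c u = c v)"
      if "A \<in> Pow ?E" for A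
    proof -
      have "finite A"
        using that by (auto intro: rev_finite_subset[OF pair_finite_arcs])
      then show ?thesis
        by (simp add: prod_of_bool case_prod_beta)
    qed
    then show "(\<Prod>a\<in>?E. 1 - of_bool (c (fst a) = c (snd a)) :: rat) =
        (\<Sum>A\<in>Pow ?E. (-1) ^ card A * of_bool (\<forall>(u, v)\<in>A. c u = c v))"
      by (subst prod_diff_conv_sum) (auto intro!: sum.cong)
  qed
  also have "\<dots> = (\<Sum>A\<in>Pow ?E. (-1) ^ card A * (\<Sum>c\<in>?M. of_bool (\<forall>(u, v)\<in>A. c u = c v)))"
    by (subst sum.swap) (simp add: sum_distrib_left)
  also have "\<dots> = (\<Sum>A\<in>Pow ?E. (-1) ^ card A * of_nat n ^ (card ?V - graphic_rank A))"
  proof (rule sum.cong[OF refl])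
    fix A assume "A \<in> Pow ?E"
    then have "card {c \<in> ?M. \<forall>(u, v) \<in> A. c u = c v} = n ^ (card ?V - graphic_rank A)"
      by (intro card_colorings_constant_on_arcs Field) auto
    moreover have "(\<Sum>c\<in>?M. of_bool (\<forall>(u, v)\<in>A. c u = c v) :: rat) =
        of_nat (card {c \<in> ?M. \<forall>(u, v) \<in> A. c u = c v})"
      using finM by (simp add: sum.inter_filter[symmetric] of_bool_def)
    ultimately show "(-1) ^ card A * (\<Sum>c\<in>?M. of_bool (\<forall>(u, v)\<in>A. c u = c v) :: rat) =
        (-1) ^ card A * of_nat n ^ (card ?V - graphic_rank A)"
      by simp
  qed
  finally show "poly (chromatic_polynomial G) (of_nat n) = poly ?p (of_nat n)"
    using poly_chromatic_polynomial[OF assms, of n] by (simp add: poly_sum poly_monom)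
qed

text \<open>Without loops only the empty arc set has rank \<open>0\<close>, so the expansion is monic of degree
  \<open>card (pverts G)\<close>. No rank exceeds this degree, and therefore the formula for the coefficients also
  covers the zeros below the constant term.\<close>

lemma
  assumes "pair_digraph G"
  shows degree_chromatic_polynomial: "degree (chromatic_polynomial G) = card (pverts G)"
    and chromatic_polynomial_nonzero: "chromatic_polynomial G \<noteq> 0"
    and coeff_from_top_chromatic_polynomial:
      "coeff_from_top (chromatic_polynomial G) r =
        (\<Sum>A | A \<subseteq> parcs G \<and> graphic_rank A = r. (-1) ^ card A)"
proof -
  interpret pair_digraph G by fact
  let ?V = "pverts G" and ?E = "parcs G" and ?p = "chromatic_polynomial G"
  have loopless: "u \<noteq> v" if "(u, v) \<in> ?E" for u v
    using no_loops'[of u v] that by auto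
  have rank_le: "graphic_rank A \<le> card ?V" if "A \<subseteq> ?E" for A
  proof -
    have "Field A \<subseteq> ?V"
      using that in_arcsD1 in_arcsD2 by (fastforce simp: Field_def)
    then show ?thesis
      using graphic_rank_le[of A] card_mono[of ?V "Field A"] by simp
  qed
  have p: "?p = (\<Sum>A\<in>Pow ?E. monom ((-1) ^ card A) (card ?V - graphic_rank A))"
    by (rule chromatic_polynomial_Whitney) (rule pair_fin_digraph)
  have coeff: "coeff ?p (card ?V - r) = (\<Sum>A | A \<subseteq> ?E \<and> graphic_rank A = r. (-1) ^ card A)"
    if "r \<le> card ?V" for r
  proof -
    have "coeff ?p (card ?V - r) =
        (\<Sum>A\<in>Pow ?E. if graphic_rank A = r then (-1) ^ card A else 0)"
      unfolding p coeff_sum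
    proof (rule sum.cong[OF refl])
      fix A assume "A \<in> Pow ?E"
      then have "graphic_rank A \<le> card ?V"
        using rank_le by blast
      then have "card ?V - graphic_rank A = card ?V - r \<longleftrightarrow> graphic_rank A = r"
        using that by linarith
      then show "coeff (monom ((-1) ^ card A) (card ?V - graphic_rank A)) (card ?V - r) =
          (if graphic_rank A = r then (-1) ^ card A else 0 :: rat)"
        by simp
    qed
    also have "\<dots> = (\<Sum>A\<in>{A \<in> Pow ?E. graphic_rank A = r}. (-1) ^ card A)"
      by (rule sum.inter_filter[symmetric]) simp
    finally show ?thesis by simp
  qed
  have rank_0: "A = {}" if "A \<subseteq> ?E" "graphic_rank A = 0" for A
  proof -
    have finA: "finite A"
      using that(1) by (auto intro: rev_finite_subset[OF pair_finite_arcs])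
    have "card (Field A) \<le> 2 * graphic_rank A"
      using that loopless by (intro card_Field_le_twice_rank[OF finA]) blast
    then have "Field A = {}"
      using that finA by (simp add: finite_Field)
    then show ?thesis by (auto simp: Field_def)
  qed
  have "{A. A \<subseteq> ?E \<and> graphic_rank A = 0} = {{}}"
    using rank_0 by (auto simp: graphic_rank_def)
  then have lead: "coeff ?p (card ?V) = 1"
    using coeff[of 0] by simp
  moreover have "degree ?p \<le> card ?V"
    unfolding p by (intro degree_sum_le) (auto intro: order.trans[OF degree_monom_le])
  ultimately show deg: "degree ?p = card ?V"
    by (metis le_antisym le_degree zero_neq_one)
  show "?p \<noteq> 0"
    using lead by auto
  have empty: "{A. A \<subseteq> ?E \<and> graphic_rank A = r} = {}" if "\<not> r \<le> card ?V"
    using rank_le that by auto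
  show "coeff_from_top ?p r = (\<Sum>A | A \<subseteq> ?E \<and> graphic_rank A = r. (-1) ^ card A)"
  proof (cases "r \<le> card ?V")
    case False
    then show ?thesis
      unfolding empty[OF False] by (simp add: coeff_from_top_def deg)
  qed (simp add: coeff coeff_from_top_def deg)
qed

section \<open>Counting by supports\<close>

lemma ex_binomial_poly: "\<exists>b :: rat poly. \<forall>q. poly b (of_nat q) = of_nat (q choose s)"
proof
  show "\<forall>q. poly (smult (1 / fact s) (\<Prod>i<s. [:- of_nat i, 1:])) (of_nat q :: rat)
      = of_nat (q choose s)"
    by (simp add: poly_prod binomial_gbinomial gbinomial_prod_rev atLeast0LessThan)
qed

text \<open>There are \<open>q choose s\<close> subsets of size \<open>s\<close>, and for fixed \<open>s\<close> this number is a polynomial in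
  \<open>q\<close>. The bound \<open>m\<close> keeps the number of sizes that contribute independent of \<open>q\<close>.\<close>

lemma ex_poly_sum_over_subsets:
  fixes F :: "nat set \<Rightarrow> rat"
  assumes inv: "\<And>S. finite S \<Longrightarrow> F S = F {..<card S}"
    and bound: "\<And>S. finite S \<Longrightarrow> m < card S \<Longrightarrow> F S = 0"
  shows "\<exists>\<phi> :: rat poly. \<forall>q. (\<Sum>S\<in>Pow {..<q}. F S) = poly \<phi> (of_nat q)"
proof -
  obtain b :: "nat \<Rightarrow> rat poly" where b: "\<And>s q. poly (b s) (of_nat q) = of_nat (q choose s)"
    using ex_binomial_poly by metis
  have "(\<Sum>S\<in>Pow {..<q}. F S) = poly (\<Sum>s\<le>m. smult (F {..<s}) (b s)) (of_nat q)" for q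
  proof -
    let ?P = "{S \<in> Pow {..<q}. card S \<le> m}"
    have fin: "finite S" if "S \<in> Pow {..<q}" for S
      using that finite_subset by auto
    have "(\<Sum>S\<in>Pow {..<q}. F S) = (\<Sum>S\<in>?P. F S)"
      using bound fin by (intro sum.mono_neutral_right) (auto simp: not_le)
    also have "\<dots> = (\<Sum>s\<le>m. \<Sum>S\<in>{S \<in> ?P. card S = s}. F S)"
      by (rule sum.group[symmetric]) auto
    also have "\<dots> = (\<Sum>s\<le>m. of_nat (q choose s) * F {..<s})"
    proof (rule sum.cong[OF refl])
      fix s assume "s \<in> {..m}"
      then have "{S \<in> ?P. card S = s} = {S. S \<subseteq> {..<q} \<and> card S = s}"
        by auto
      moreover have "card \<dots> = q choose s"
        using n_subsets[of "{..<q}" s] by simp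
      moreover have "(\<Sum>S\<in>{S \<in> ?P. card S = s}. F S) = (\<Sum>S\<in>{S \<in> ?P. card S = s}. F {..<s})"
      proof (rule sum.cong[OF refl])
        fix S assume "S \<in> {S \<in> ?P. card S = s}"
        then show "F S = F {..<s}"
          using inv[of S] fin[of S] by simp
      qed
      ultimately show "(\<Sum>S\<in>{S \<in> ?P. card S = s}. F S) = of_nat (q choose s) * F {..<s}"
        by simp
    qed
    finally show ?thesis
      by (simp add: poly_sum b mult.commute)
  qed
  then show ?thesis by blast
qed

text \<open>A bijection between two finite alphabets is obtained from an injection of all of \<^typ>\<open>nat\<close>, so
  that renaming the letters of words is injective without restriction to a set of words.\<close>

lemma ex_inj_image_lessThan:
  fixes S :: "nat set"
  assumes "finite S"
  shows "\<exists>f :: nat \<Rightarrow> nat. inj f \<and> f ` {..<card S} = S"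
proof -
  obtain b where b: "bij_betw b {..<card S} S"
    using ex_bij_betw_nat_finite[OF assms] atLeast0LessThan by metis
  obtain m where m: "\<And>x. x \<in> S \<Longrightarrow> x < m"
    using assms by (auto simp: finite_nat_set_iff_bounded)
  \<comment> \<open>Adding \<open>m\<close> moves the remaining numbers beyond \<open>S\<close>.\<close>
  let ?f = "\<lambda>i. if i < card S then b i else i + m"
  have "b i < m" if "i < card S" for i
    using that b m by (auto simp: bij_betw_def)
  then have "inj ?f"
    using b by (fastforce simp: inj_def bij_betw_def inj_on_def)
  moreover have "?f ` {..<card S} = S"
    using b by (simp add: bij_betw_def)
  ultimately show ?thesis by blast
qed

section \<open>Powers of complete graphs\<close>

text \<open>The arcs of all the graphs \<open>K\<^sub>q\<^sup>k\<close> together: the alphabet is the whole type.\<close>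

definition hamming_arcs :: "nat \<Rightarrow> 'a list rel" where
  "hamming_arcs k =
    {(xs, ys). length xs = k \<and> length ys = k \<and> card {i. i < k \<and> xs ! i \<noteq> ys ! i} = 1}"

definition letters :: "'a list rel \<Rightarrow> 'a set" where
  "letters A = \<Union> (set ` Field A)"

text \<open>The size \<open>q\<close> of the alphabet constrains an arc set only through its letters.\<close>

lemma subset_parcs_cartesian_power_complete:
  "A \<subseteq> parcs (cartesian_power (complete_graph q) k) \<longleftrightarrow>
    A \<subseteq> hamming_arcs k \<and> letters A \<subseteq> {..<q}"
proof -
  have "letters A \<subseteq> {..<q} \<longleftrightarrow> (\<forall>(xs, ys) \<in> A. set xs \<subseteq> {..<q} \<and> set ys \<subseteq> {..<q})"
    unfolding letters_def Field_def UN_subset_iff by auto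
  moreover have "(xs, ys) \<in> parcs (cartesian_power (complete_graph q) k) \<longleftrightarrow>
      (xs, ys) \<in> hamming_arcs k \<and> set xs \<subseteq> {..<q} \<and> set ys \<subseteq> {..<q}" for xs ys
    by (auto simp: parcs_cartesian_power_complete pverts_cartesian_power hamming_arcs_def)
  ultimately show ?thesis
    unfolding subset_eq by fast
qed

lemma map_prod_hamming_arcs:
  assumes "inj f"
  shows "map_prod (map f) (map f) ` A \<subseteq> hamming_arcs k \<longleftrightarrow> A \<subseteq> hamming_arcs k"
proof -
  have "(map f xs, map f ys) \<in> hamming_arcs k \<longleftrightarrow> (xs, ys) \<in> hamming_arcs k" for xs ys
  proof (cases "length xs = k \<and> length ys = k")
    case True
    then have "{i. i < k \<and> map f xs ! i \<noteq> map f ys ! i} = {i. i < k \<and> xs ! i \<noteq> ys ! i}"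
      using assms by (auto simp: inj_eq)
    then show ?thesis
      by (simp add: hamming_arcs_def)
  qed (auto simp: hamming_arcs_def)
  then show ?thesis
    by (auto simp: image_subset_iff subset_eq)
qed

lemma hamming_arcs_irrefl: "(u, v) \<in> hamming_arcs k \<Longrightarrow> u \<noteq> v"
  by (auto simp: hamming_arcs_def)

lemma letters_map_prod: "letters (map_prod (map f) (map f) ` A) = f ` letters A"
  by (auto simp: letters_def Field_map_prod)

lemma finite_hamming_arcs_letters:
  assumes "finite S" and "A \<subseteq> hamming_arcs k" and "letters A \<subseteq> S"
  shows "finite A"
proof (rule finite_subset)
  let ?L = "{xs. set xs \<subseteq> S \<and> length xs = k}"
  show "A \<subseteq> ?L \<times> ?L"
  proof (rule subrelI)
    fix xs ys assume "(xs, ys) \<in> A"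
    then have "set xs \<subseteq> letters A" "set ys \<subseteq> letters A" "(xs, ys) \<in> hamming_arcs k"
      using assms(2) by (auto simp: letters_def Field_def)
    then show "(xs, ys) \<in> ?L \<times> ?L"
      using assms(3) by (auto simp: hamming_arcs_def)
  qed
  show "finite (?L \<times> ?L)"
    using finite_lists_length_eq[OF assms(1)] by blast
qed

lemma card_letters_le:
  assumes "finite A" and "A \<subseteq> hamming_arcs k"
  shows "card (letters A) \<le> 2 * graphic_rank A * k"
proof -
  have finF: "finite (Field A)"
    using assms(1) by (simp add: finite_Field)
  have len: "length xs = k" if "xs \<in> Field A" for xs
    using that assms(2) by (auto simp: Field_def hamming_arcs_def)
  have "card (letters A) \<le> (\<Sum>xs\<in>Field A. card (set xs))"
    unfolding letters_def by (rule card_UN_le[OF finF])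
  also have "\<dots> \<le> (\<Sum>xs\<in>Field A. k)"
    using len card_length by (intro sum_mono) blast
  also have "\<dots> = card (Field A) * k"
    by simp
  also have "\<dots> \<le> 2 * graphic_rank A * k"
    using assms hamming_arcs_irrefl
    by (intro mult_right_mono card_Field_le_twice_rank) blast+
  finally show ?thesis .
qed

text \<open>Renaming letters by \<open>f\<close> is a bijection between the two ranges of summation, and it preserves
  cardinality and rank. An arc set with letters in \<open>f ` S\<close> is the image of the one obtained by
  applying \<open>inv f\<close> to its letters.\<close>

lemma sum_over_letters_inj:
  fixes f :: "nat \<Rightarrow> nat"
  assumes f: "inj f"
  shows "(\<Sum>A | A \<subseteq> hamming_arcs k \<and> letters A = f ` S \<and> graphic_rank A = r. (-1) ^ card A :: rat) =
    (\<Sum>A | A \<subseteq> hamming_arcs k \<and> letters A = S \<and> graphic_rank A = r. (-1) ^ card A)"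
    (is "sum _ (?X (f ` S)) = sum _ (?X S)")
proof -
  let ?h = "map_prod (map f) (map f)"
  have inj_map: "inj (map f)"
    using f by simp
  have inj_h: "inj ?h"
    using inj_map by (simp add: prod.inj_map)
  have "(`) ?h ` ?X S = ?X (f ` S)"
  proof
    show "(`) ?h ` ?X S \<subseteq> ?X (f ` S)"
    proof clarify
      fix A :: "nat list rel"
      assume "A \<subseteq> hamming_arcs k"
      then show "?h ` A \<subseteq> hamming_arcs k \<and> letters (?h ` A) = f ` letters A \<and>
          graphic_rank (?h ` A) = graphic_rank A"
        by (simp add: map_prod_hamming_arcs[OF f] letters_map_prod graphic_rank_map_prod[OF inj_map])
    qed
  next
    show "?X (f ` S) \<subseteq> (`) ?h ` ?X S"
    proof
      fix B assume B: "B \<in> ?X (f ` S)"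
      let ?A = "map_prod (map (inv f)) (map (inv f)) ` B"
      have "?h (map_prod (map (inv f)) (map (inv f)) a) = a" if a: "a \<in> B" for a
      proof -
        obtain xs ys where xy: "a = (xs, ys)"
          by (cases a)
        have "set xs \<union> set ys \<subseteq> letters B"
          using a xy by (auto simp: letters_def Field_def)
        then have "f (inv f x) = x" if "x \<in> set xs \<union> set ys" for x
          using that B by (intro f_inv_into_f) auto
        then show ?thesis
          by (simp add: xy map_idI)
      qed
      then have hA: "?h ` ?A = B"
        unfolding image_image by simp
      have "?A \<subseteq> hamming_arcs k"
        using B hA map_prod_hamming_arcs[OF f, of ?A k] by simp
      moreover have "graphic_rank ?A = r"
        using B hA graphic_rank_map_prod[OF inj_map, of ?A] by simp
      moreover have "letters ?A = S"
        using B hA letters_map_prod[of f ?A] f by (simp add: inj_image_eq_iff)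
      ultimately show "B \<in> (`) ?h ` ?X S"
        by (intro image_eqI[where x = ?A]) (use hA in auto)
    qed
  qed
  moreover have "inj_on ((`) ?h) (?X S)"
    by (rule inj_onI) (simp add: inj_image_eq_iff[OF inj_h])
  moreover have "card (?h ` A) = card A" for A
    by (rule card_image) (rule inj_on_subset[OF inj_h subset_UNIV])
  ultimately show ?thesis
    by (intro sum.reindex_cong[where l = "(`) ?h"]) simp_all
qed

lemma coeff_from_top_cartesian_power_complete_poly:
  "\<exists>\<phi> :: rat poly. \<forall>q. coeff_from_top (chromatic_polynomial (cartesian_power (complete_graph q) k)) r
    = poly \<phi> (of_nat q)"
proof -
  let ?X = "\<lambda>S. {A :: nat list rel. A \<subseteq> hamming_arcs k \<and> letters A = S \<and> graphic_rank A = r}"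
  let ?F = "\<lambda>S. \<Sum>A\<in>?X S. (-1) ^ card A :: rat"
  have "\<exists>\<phi> :: rat poly. \<forall>q. (\<Sum>S\<in>Pow {..<q}. ?F S) = poly \<phi> (of_nat q)"
  proof (rule ex_poly_sum_over_subsets)
    fix S :: "nat set" assume S: "finite S"
    then obtain f :: "nat \<Rightarrow> nat" where "inj f" "f ` {..<card S} = S"
      using ex_inj_image_lessThan by blast
    then show "?F S = ?F {..<card S}"
      using sum_over_letters_inj[of f k "{..<card S}" r] by simp
    assume "2 * r * k < card S"
    then have "?X S = {}"
      using card_letters_le finite_hamming_arcs_letters[OF S] by (auto simp flip: not_le)
    then show "?F S = 0"
      by (simp only: sum.empty)
  qed
  moreover have "coeff_from_top (chromatic_polynomial (cartesian_power (complete_graph q) k)) r =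
      (\<Sum>S\<in>Pow {..<q}. ?F S)" for q
  proof -
    let ?G = "cartesian_power (complete_graph q) k"
    interpret pair_graph ?G
      by (rule pair_graph_cartesian_power_complete)
    let ?Y = "{A. A \<subseteq> parcs ?G \<and> graphic_rank A = r}"
    have fin: "finite ?Y"
      by (rule finite_subset[of _ "Pow (parcs ?G)"]) auto
    have "coeff_from_top (chromatic_polynomial ?G) r = (\<Sum>A\<in>?Y. (-1) ^ card A)"
      by (rule coeff_from_top_chromatic_polynomial) (rule pair_digraph)
    also have "\<dots> = (\<Sum>S\<in>Pow {..<q}. \<Sum>A\<in>{A \<in> ?Y. letters A = S}. (-1) ^ card A)"
      using fin by (intro sum.group[symmetric])
        (auto simp: subset_parcs_cartesian_power_complete)
    also have "\<dots> = (\<Sum>S\<in>Pow {..<q}. ?F S)"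
      by (intro sum.cong[OF refl] sum.cong)
        (auto simp: subset_parcs_cartesian_power_complete)
    finally show ?thesis .
  qed
  ultimately show ?thesis
    by simp
qed

theorem theorem32:
  fixes k :: nat
  assumes "0 < k"
  shows "two_level_polynomial (monom 1 k) (\<lambda>q. \<infinity>)
    (\<lambda>q. chromatic_polynomial (cartesian_power (complete_graph q) k))"
proof -
  let ?G = "\<lambda>q. cartesian_power (complete_graph q) k"
  have G: "pair_digraph (?G q)" for q
  proof -
    interpret pair_graph "?G q"
      by (rule pair_graph_cartesian_power_complete)
    show ?thesis ..
  qed
  have "card (pverts (?G q)) = q ^ k" for q
    using card_lists_length_eq[of "{..<q}" k] by (simp add: pverts_cartesian_power conj_commute)
  then have "degree (chromatic_polynomial (?G q)) = q ^ k" for q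
    using degree_chromatic_polynomial[OF G] by simp
  moreover have "\<exists>\<phi> :: nat \<Rightarrow> rat poly. \<forall>q r.
      coeff_from_top (chromatic_polynomial (?G q)) r = poly (\<phi> r) (of_nat q)"
    using coeff_from_top_cartesian_power_complete_poly[of k] by metis
  ultimately show ?thesis
    using chromatic_polynomial_nonzero[OF G]
    by (auto simp: two_level_polynomial_def numerical_poly_def eventually_nonneg_poly_def
        poly_monom)
qed

end
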